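(* Let $\Gamma$ be a sign-symmetric Boolean constraint language that is not preserved by the partial $k$-NU operation $n_k$ for any $k \geq 3$. Then one of the following holds: (1) $\Gamma$ can qfpp-define all $k$-clauses, for every $k$; (2) $\Gamma$ can qfpp-define the $1$-in-$k$ relation $\{(x_1,\dots,x_k)\in\{0,1\}^k : x_1+\dots+x_k = 1\}$ for every $k$; (3) there is a fixed prime $p$ such that, for every arity $k$ and every $0 \leq a < p$, $\Gamma$ can qfpp-define the relation $\{(x_1,\dots,x_k) \in \{0,1\}^k : \sum_{i=1}^k x_i \equiv a \pmod p\}$.
   Context: A Boolean constraint language is a (possibly infinite) set of relations $R \subseteq \{0,1\}^{r}$ of finite arities. For a tuple $t \in \{0,1\}^n$ and a sign pattern $s \in \{+,-\}^n$, $t^s$ is obtained from $t$ by replacing $t[i]$ by $1-t[i]$ whenever $s[i]=-$; $R^s = \{t^s : t \in R\}$. $\Gamma$ is sign-symmetric if for every $n$-ary $R \in \Gamma$: $R^s \in \Gamma$ for every sign pattern $s$, and $R_{i=c} = \{t \in R : t[i]=c\} \in \Gamma$ for every $i \in [n]$, $c \in \{0,1\}$. A relation $R$ is qfpp-definable over $\Gamma$ if $R(x_1,\dots,x_k) \equiv R_1(\mathbf{x}_1)\wedge\dots\wedge R_m(\mathbf{x}_m)$ where each $R_i \in \Gamma \cup \{=\}$ and each $\mathbf{x}_i$ is a tuple of variables from $\{x_1,\dots,x_k\}$ (repetitions allowed), without existential quantification. A $k$-clause is a relation $\{0,1\}^k \setminus \{t\}$ for some $t \in \{0,1\}^k$.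 Partial operations, preservation: a $k$-ary partial operation $f$ on $\{0,1\}$ is applied to tuples coordinatewise, being defined iff it is defined in every coordinate; $R$ is preserved by $f$ if every defined application of $f$ to tuples of $R$ yields a tuple of $R$. The partial $k$-NU operation $n_k$ ($k\geq 3$) is the $k$-ary partial operation defined exactly on tuples of the form $(x,\dots,x,y,x,\dots,x)$ (at most one deviating position) with value $x$.
   Formalization: In "sign-symmetric", R_{i=c} is taken with the fixed coordinate i removed (an (n-1)-ary relation, for n ≥ 2); keeping it makes the claim false, e.g. for the language of all relations R × {c}. Arities k ≥ 1 are meant. *)

theory Defs
  imports "HOL-Computational_Algebra.Primes"
begin

text \<open>
  Tuples over the Boolean domain are lists, with positions numbered from 0.  A relation is paired
  with its arity, so that the empty relations of different arities are distinct.
\<close>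

type_synonym brel = "nat \<times> bool list set"

definition cube :: "nat \<Rightarrow> bool list set" where
  "cube n = {t. length t = n}"

definition constraint_language :: "brel set \<Rightarrow> bool" where
  "constraint_language \<Gamma> \<longleftrightarrow> (\<forall>(n, R) \<in> \<Gamma>. R \<subseteq> cube n)"


subsection \<open>Sign-symmetric languages\<close>

datatype sign = Plus | Minus

definition sign_tuple :: "sign list \<Rightarrow> bool list \<Rightarrow> bool list" where
  "sign_tuple s t = map2 (\<lambda>\<sigma> b. if \<sigma> = Minus then \<not> b else b) s t"

definition drop_coord :: "nat \<Rightarrow> bool list \<Rightarrow> bool list" where
  "drop_coord i t = take i t @ drop (Suc i) t"

text \<open>
  The relation obtained from \<open>R\<close> by fixing argument \<open>i\<close> to the constant \<open>c\<close>.  It is regarded as a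
  relation on the remaining arguments: the constant coordinate is not kept.
\<close>

definition fix_coord :: "nat \<Rightarrow> bool \<Rightarrow> bool list set \<Rightarrow> bool list set" where
  "fix_coord i c R = drop_coord i ` {t \<in> R. t ! i = c}"

text \<open>
  If the constant coordinate were kept as an \<open>n\<close>-th argument, then the language of all relations of
  the form \<open>R \<times> {c}\<close> would be sign-symmetric and preserved by no partial near-unanimity operation,
  although each of its constraints forces a variable to be constant, so that it can define neither
  the 3-clauses, nor 1-in-3, nor the modular relations.  Unary relations are exempt from the
  closure under fixing, so that no relations of arity 0 are required.
\<close>

definition sign_symmetric :: "brel set \<Rightarrow> bool" where
  "sign_symmetric \<Gamma> \<longleftrightarrow>
     (\<forall>(n, R) \<in> \<Gamma>.
        (\<forall>s. length s = n \<longrightarrow> (n, sign_tuple s ` R) \<in> \<Gamma>) \<and>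
        (2 \<le> n \<longrightarrow> (\<forall>i<n. \<forall>c. (n - 1, fix_coord i c R) \<in> \<Gamma>)))"


subsection \<open>Quantifier-free primitive positive definitions\<close>

definition eq_rel :: brel where
  "eq_rel = (2, {t \<in> cube 2. t ! 0 = t ! 1})"

text \<open>
  An atom \<open>((n, S), vs)\<close> is the constraint \<open>S(x\<^bsub>vs!0\<^esub>, \<dots>, x\<^bsub>vs!(n-1)\<^esub>)\<close>; a list of atoms is read
  as their conjunction.
\<close>

definition qfpp_definable :: "brel set \<Rightarrow> nat \<Rightarrow> bool list set \<Rightarrow> bool" where
  "qfpp_definable \<Gamma> k R \<longleftrightarrow>
     (\<exists>atoms :: (brel \<times> nat list) list.
        (\<forall>((n, S), vs) \<in> set atoms. (n, S) \<in> insert eq_rel \<Gamma> \<and> length vs = n \<and> set vs \<subseteq> {..<k}) \<and>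
        R = {t \<in> cube k. \<forall>((n, S), vs) \<in> set atoms. map (\<lambda>i. t ! i) vs \<in> S})"


subsection \<open>Partial operations\<close>

text \<open>A partial operation is a function into \<open>bool option\<close>, undefined where it yields \<open>None\<close>.\<close>

type_synonym partial_op = "bool list \<Rightarrow> bool option"

definition preserves :: "nat \<Rightarrow> partial_op \<Rightarrow> brel \<Rightarrow> bool" where
  "preserves k f = (\<lambda>(n, R).
     \<forall>ts u. length ts = k \<and> set ts \<subseteq> R \<and> length u = n \<and>
            (\<forall>i<n. f (map (\<lambda>t. t ! i) ts) = Some (u ! i)) \<longrightarrow> u \<in> R)"

definition preserves_language :: "nat \<Rightarrow> partial_op \<Rightarrow> brel set \<Rightarrow> bool" where
  "preserves_language k f \<Gamma> \<longleftrightarrow> (\<forall>\<rho> \<in> \<Gamma>. preserves k f \<rho>)"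

definition nearly_constant :: "bool \<Rightarrow> bool list \<Rightarrow> bool" where
  "nearly_constant x xs \<longleftrightarrow> card {i. i < length xs \<and> xs ! i \<noteq> x} \<le> 1"

text \<open>For \<open>k \<ge> 3\<close> a \<open>k\<close>-tuple is nearly constant for at most one value, so the order of the tests is
  immaterial.\<close>

definition partial_nu :: "nat \<Rightarrow> partial_op" where
  "partial_nu k xs =
     (if length xs = k \<and> nearly_constant False xs then Some False
      else if length xs = k \<and> nearly_constant True xs then Some True
      else None)"


subsection \<open>Target relations\<close>

definition clauses :: "nat \<Rightarrow> bool list set set" where
  "clauses k = {cube k - {t} | t. t \<in> cube k}"

definition weight :: "bool list \<Rightarrow> nat" where
  "weight t = (\<Sum>i<length t. of_bool (t ! i))"

definition one_in :: "nat \<Rightarrow> bool list set" where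
  "one_in k = {t \<in> cube k. weight t = 1}"

definition mod_rel :: "nat \<Rightarrow> nat \<Rightarrow> nat \<Rightarrow> bool list set" where
  "mod_rel p a k = {t \<in> cube k. weight t mod p = a mod p}"

end

theory Submission
  imports Defs "HOL-Combinatorics.Permutations"
begin

text \<open>
  Failure of \<open>n\<^sub>k\<close> yields, after changing signs and fixing and identifying variables, a relation
  of arity \<open>k\<close> that contains all unit vectors but not the zero vector.  Intersecting it with all its
  coordinate permutations makes it symmetric, hence described by a set of weights.  Fixing and
  identifying variables turn a weight set \<open>W\<close> into \<open>{j. m * j + c \<in> W}\<close>.  There is a least weight set
  \<open>W \<subseteq> \<nat>\<close> containing 1 that is definable in all arities at once, and \<open>0 \<notin> W\<close>.  For \<open>a + 1 \<in> W\<close> the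
  shift \<open>{j. j + a \<in> W}\<close> contains 1 too, so minimality makes \<open>{a. a + 1 \<in> W}\<close> a numerical semigroup.
  If it is \<open>{0}\<close>, then \<open>W = {1}\<close> gives 1-in-k.  Otherwise it agrees from some point on with the
  multiples of some \<open>d\<close>: for \<open>d = 1\<close>, multiplying by a large \<open>m\<close> gives the weight set \<open>{j. j \<ge> 1}\<close>,
  i.e. the clauses, and for \<open>d \<ge> 2\<close>, large shifts give the congruences modulo any prime divisor of \<open>d\<close>.
\<close>

section \<open>Closure properties of qfpp-definability\<close>

lemma qfpp_definable_cube: "qfpp_definable \<Gamma> k (cube k)"
  unfolding qfpp_definable_def by (intro exI[of _ "[]"]) auto

lemma qfpp_definable_Int:
  assumes "qfpp_definable \<Gamma> k A" "qfpp_definable \<Gamma> k B"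
  shows "qfpp_definable \<Gamma> k (A \<inter> B)"
proof -
  obtain as where as: "\<forall>((n, S), vs) \<in> set as. (n, S) \<in> insert eq_rel \<Gamma> \<and> length vs = n \<and> set vs \<subseteq> {..<k}"
    "A = {t \<in> cube k. \<forall>((n, S), vs) \<in> set as. map (\<lambda>i. t ! i) vs \<in> S}"
    using assms(1) unfolding qfpp_definable_def by blast
  obtain bs where bs: "\<forall>((n, S), vs) \<in> set bs. (n, S) \<in> insert eq_rel \<Gamma> \<and> length vs = n \<and> set vs \<subseteq> {..<k}"
    "B = {t \<in> cube k. \<forall>((n, S), vs) \<in> set bs. map (\<lambda>i. t ! i) vs \<in> S}"
    using assms(2) unfolding qfpp_definable_def by blast
  show ?thesis
    unfolding qfpp_definable_def
  proof (intro exI[of _ "as @ bs"] conjI)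
    show "\<forall>((n, S), vs) \<in> set (as @ bs).
        (n, S) \<in> insert eq_rel \<Gamma> \<and> length vs = n \<and> set vs \<subseteq> {..<k}"
      using as(1) bs(1) by (simp add: ball_Un)
    show "A \<inter> B = {t \<in> cube k. \<forall>((n, S), vs) \<in> set (as @ bs). map (\<lambda>i. t ! i) vs \<in> S}"
      unfolding as(2) bs(2) by (simp add: ball_Un set_eq_iff) blast
  qed
qed

lemma qfpp_definable_atom:
  assumes "(n, S) \<in> \<Gamma>" "length vs = n" "set vs \<subseteq> {..<k}"
  shows "qfpp_definable \<Gamma> k {t \<in> cube k. map (\<lambda>i. t ! i) vs \<in> S}"
  unfolding qfpp_definable_def
  by (rule exI[of _ "[((n, S), vs)]"]) (use assms in auto)

text \<open>Serves to write an empty relation of arity \<open>k\<close> as two contradictory unary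
  constraints on the first variable.\<close>

lemma qfpp_definable_weaken_arity:
  assumes "qfpp_definable \<Gamma> n R" "n \<le> k"
  shows "qfpp_definable \<Gamma> k {t \<in> cube k. take n t \<in> R}"
proof -
  obtain as where as: "\<forall>((n', S), vs) \<in> set as. (n', S) \<in> insert eq_rel \<Gamma> \<and> length vs = n' \<and> set vs \<subseteq> {..<n}"
    "R = {t \<in> cube n. \<forall>((n, S), vs) \<in> set as. map (\<lambda>i. t ! i) vs \<in> S}"
    using assms(1) unfolding qfpp_definable_def by blast
  have eq: "map ((!) (take n t)) vs = map ((!) t) vs" if "((m, S), vs) \<in> set as" for t :: "bool list" and m S vs
    using as(1) that by (fastforce intro!: map_cong)
  have eq': "(\<forall>((m, S), vs) \<in> set as. map ((!) (take n t)) vs \<in> S)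
      \<longleftrightarrow> (\<forall>((m, S), vs) \<in> set as. map ((!) t) vs \<in> S)" for t
    by (intro ball_cong refl) (clarsimp simp only: eq)
  show ?thesis
    unfolding qfpp_definable_def
  proof (intro exI[of _ as] conjI)
    show "\<forall>((n, S), vs) \<in> set as. (n, S) \<in> insert eq_rel \<Gamma> \<and> length vs = n \<and> set vs \<subseteq> {..<k}"
      using as(1) assms(2) by fastforce
    show "{t \<in> cube k. take n t \<in> R} =
        {t \<in> cube k. \<forall>((n, S), vs) \<in> set as. map (\<lambda>i. t ! i) vs \<in> S}"
      unfolding as(2) using assms(2) by (auto simp: cube_def eq')
  qed
qed


section \<open>Definitions with constants and negated variables\<close>

text \<open>Signs and constants sit at the arguments of an atom, not in its relation, so that
  negating, fixing, identifying and permuting variables are all substitutions.\<close>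

datatype arg = Const bool | Lit bool nat

fun eval_arg :: "bool list \<Rightarrow> arg \<Rightarrow> bool" where
  "eval_arg t (Const c) = c"
| "eval_arg t (Lit b i) = (t ! i \<noteq> b)"

fun arg_ok :: "nat \<Rightarrow> arg \<Rightarrow> bool" where
  "arg_ok k (Const c) = True"
| "arg_ok k (Lit b i) = (i < k)"

fun flip_arg :: "bool \<Rightarrow> arg \<Rightarrow> arg" where
  "flip_arg b (Const c) = Const (c \<noteq> b)"
| "flip_arg b (Lit b' i) = Lit (b' \<noteq> b) i"

fun subst_arg :: "arg list \<Rightarrow> arg \<Rightarrow> arg" where
  "subst_arg as (Const c) = Const c"
| "subst_arg as (Lit b i) = flip_arg b (as ! i)"

fun is_const :: "arg \<Rightarrow> bool" where
  "is_const (Const c) = True"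
| "is_const (Lit b i) = False"

lemma eval_flip_arg [simp]: "eval_arg t (flip_arg b a) = (eval_arg t a \<noteq> b)"
  by (cases a) auto

lemma arg_ok_flip_arg [simp]: "arg_ok k (flip_arg b a) = arg_ok k a"
  by (cases a) auto

lemma eval_subst_arg:
  "arg_ok (length as) a \<Longrightarrow> eval_arg t (subst_arg as a) = eval_arg (map (eval_arg t) as) a"
  by (cases a) auto

lemma arg_ok_subst_arg:
  "arg_ok (length as) a \<Longrightarrow> \<forall>x \<in> set as. arg_ok k x \<Longrightarrow> arg_ok k (subst_arg as a)"
  by (cases a) auto

text \<open>A working notion of definability that is closed under substitution by design;
  sign-symmetry is what translates it back to \<open>qfpp_definable\<close>.\<close>

inductive lit_definable :: "brel set \<Rightarrow> nat \<Rightarrow> bool list set \<Rightarrow> bool" for \<Gamma> k where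
  cube: "lit_definable \<Gamma> k (cube k)"
| atom: "(n, S) \<in> \<Gamma> \<Longrightarrow> length as = n \<Longrightarrow> \<forall>a \<in> set as. arg_ok k a \<Longrightarrow>
    lit_definable \<Gamma> k {t \<in> cube k. map (eval_arg t) as \<in> S}"
| Int: "lit_definable \<Gamma> k A \<Longrightarrow> lit_definable \<Gamma> k B \<Longrightarrow> lit_definable \<Gamma> k (A \<inter> B)"

text \<open>Composing the two argument lists turns each atom into an atom.\<close>

lemma lit_definable_subst:
  assumes "lit_definable \<Gamma> n R" "length as = n" "\<forall>a \<in> set as. arg_ok k a"
  shows "lit_definable \<Gamma> k {t \<in> cube k. map (eval_arg t) as \<in> R}"
  using assms(1)
proof induction
  case cube
  have "{t \<in> cube k. map (eval_arg t) as \<in> cube n} = cube k"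
    using assms(2) by (auto simp: cube_def)
  then show ?case by (simp add: lit_definable.cube)
next
  case (atom m S bs)
  have eq: "map (eval_arg t) (map (subst_arg as) bs) = map (eval_arg (map (eval_arg t) as)) bs" for t
    using atom assms(2) by (simp add: eval_subst_arg)
  have "lit_definable \<Gamma> k {t \<in> cube k. map (eval_arg t) (map (subst_arg as) bs) \<in> S}"
    using atom assms by (intro lit_definable.atom[of m]) (auto intro: arg_ok_subst_arg)
  moreover have "{t \<in> cube k. map (eval_arg t) as \<in> {t \<in> cube n. map (eval_arg t) bs \<in> S}}
      = {t \<in> cube k. map (eval_arg t) (map (subst_arg as) bs) \<in> S}"
    unfolding eq using assms(2) by (auto simp: cube_def)
  ultimately show ?case by simp
next
  case (Int A B)
  have "{t \<in> cube k. map (eval_arg t) as \<in> A \<inter> B}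
      = {t \<in> cube k. map (eval_arg t) as \<in> A} \<inter> {t \<in> cube k. map (eval_arg t) as \<in> B}" by auto
  with Int.IH show ?case by (simp add: lit_definable.Int)
qed

lemma lit_definable_INT:
  assumes "finite I" "\<And>i. i \<in> I \<Longrightarrow> lit_definable \<Gamma> k (A i)"
  shows "lit_definable \<Gamma> k (cube k \<inter> (\<Inter>i\<in>I. A i))"
  using assms
proof (induction I rule: finite_induct)
  case empty
  then show ?case by (simp add: lit_definable.cube)
next
  case (insert i I)
  have "cube k \<inter> (\<Inter>i\<in>insert i I. A i) = A i \<inter> (cube k \<inter> (\<Inter>i\<in>I. A i))" by auto
  with insert show ?case by (simp add: lit_definable.Int)
qed

section \<open>Removing negations and constants from atoms\<close>

lemma sign_tuple_involution:
  "length s = length t \<Longrightarrow> sign_tuple s (sign_tuple s t) = t"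
  by (rule nth_equalityI) (auto simp: sign_tuple_def)

text \<open>Coordinate \<open>i\<close> and the remaining ones determine a tuple, so deleting a
  coordinate of known value loses nothing.\<close>

lemma mem_fix_coord_iff:
  assumes "S \<subseteq> cube n" "length x = n" "i < n"
  shows "drop_coord i x \<in> fix_coord i (x ! i) S \<longleftrightarrow> x \<in> S"
proof
  assume "drop_coord i x \<in> fix_coord i (x ! i) S"
  then obtain y where y: "y \<in> S" "y ! i = x ! i" "drop_coord i x = drop_coord i y"
    by (auto simp: fix_coord_def)
  have len: "length y = n" using y(1) assms(1) by (auto simp: cube_def)
  from y(3) len assms have "take i x = take i y" "drop (Suc i) x = drop (Suc i) y"
    by (auto simp: drop_coord_def append_eq_append_conv)
  then have "x = y"
    using y(2) len assms id_take_nth_drop[of i x] id_take_nth_drop[of i y] by simp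
  then show "x \<in> S" using y(1) by simp
qed (auto simp: fix_coord_def)

text \<open>The negations move from the arguments into the relation as a sign pattern, which
  \<open>\<Gamma>\<close> absorbs; applying a pattern twice is the identity.\<close>

lemma lit_atom_definable_without_constants:
  assumes cl: "constraint_language \<Gamma>" and sym: "sign_symmetric \<Gamma>"
    and "(n, S) \<in> \<Gamma>" "length as = n" "\<forall>a \<in> set as. arg_ok k a \<and> \<not> is_const a"
  shows "qfpp_definable \<Gamma> k {t \<in> cube k. map (eval_arg t) as \<in> S}"
proof -
  \<comment> \<open>The values for \<open>Const\<close> here and in \<open>vs\<close> are dummies:
    no argument is a constant.\<close>
  define s where "s = map (case_arg (\<lambda>_. Plus) (\<lambda>b _. if b then Minus else Plus)) as"
  define vs where "vs = map (case_arg (\<lambda>_. 0) (\<lambda>_ i. i)) as"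
  have ls: "length s = n" using assms by (simp add: s_def)
  have SS: "S \<subseteq> cube n" using cl assms(3) by (auto simp: constraint_language_def)
  have ok: "set vs \<subseteq> {..<k}"
  proof
    fix v assume "v \<in> set vs"
    then obtain a where "a \<in> set as" "v = case_arg (\<lambda>_. 0) (\<lambda>_ i. i) a"
      by (auto simp: vs_def)
    with assms(5) show "v \<in> {..<k}" by (cases a) auto
  qed
  have ev: "map (eval_arg t) as = sign_tuple s (map ((!) t) vs)" for t
  proof (rule nth_equalityI)
    fix i assume "i < length (map (eval_arg t) as)"
    then have "i < length as" "\<not> is_const (as ! i)" using assms by auto
    then show "map (eval_arg t) as ! i = sign_tuple s (map ((!) t) vs) ! i"
      by (cases "as ! i") (auto simp: sign_tuple_def s_def vs_def)
  qed (simp add: sign_tuple_def s_def vs_def)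
  have "map (eval_arg t) as \<in> S \<longleftrightarrow> map ((!) t) vs \<in> sign_tuple s ` S" for t
  proof
    assume "map (eval_arg t) as \<in> S"
    moreover have "map ((!) t) vs = sign_tuple s (map (eval_arg t) as)"
      unfolding ev using ls assms(4) by (simp add: sign_tuple_involution vs_def)
    ultimately show "map ((!) t) vs \<in> sign_tuple s ` S" by blast
  next
    assume "map ((!) t) vs \<in> sign_tuple s ` S"
    then obtain x where "x \<in> S" "map ((!) t) vs = sign_tuple s x" by auto
    then show "map (eval_arg t) as \<in> S"
      using SS ls unfolding ev by (auto simp: sign_tuple_involution cube_def)
  qed
  moreover have "(n, sign_tuple s ` S) \<in> \<Gamma>"
    using sym assms(3) ls unfolding sign_symmetric_def by auto
  then have "qfpp_definable \<Gamma> k {t \<in> cube k. map (\<lambda>i. t ! i) vs \<in> sign_tuple s ` S}"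
    by (rule qfpp_definable_atom) (use ok assms(4) in \<open>auto simp: vs_def\<close>)
  ultimately show ?thesis by simp
qed

text \<open>Constant arguments are removed one at a time by \<open>fix_coord\<close>, each lowering
  the arity by one, until only literals remain.\<close>

lemma lit_atom_definable:
  assumes cl: "constraint_language \<Gamma>" and sym: "sign_symmetric \<Gamma>"
    and "(n, S) \<in> \<Gamma>" "length as = n" "\<forall>a \<in> set as. arg_ok k a"
    and "{t \<in> cube k. map (eval_arg t) as \<in> S} \<noteq> {}"
  shows "qfpp_definable \<Gamma> k {t \<in> cube k. map (eval_arg t) as \<in> S}"
  using assms(3-)
proof (induction n arbitrary: S as)
  case 0
  then show ?case
    by (intro lit_atom_definable_without_constants[OF cl sym]) auto
next
  case (Suc n)
  show ?case
  proof (cases "\<exists>a\<in>set as. is_const a")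
    case False
    with Suc.prems show ?thesis
      by (intro lit_atom_definable_without_constants[OF cl sym]) auto
  next
    case True
    then obtain i where i: "i < Suc n" "is_const (as ! i)"
      using Suc.prems(2) by (metis in_set_conv_nth)
    then obtain c where c: "as ! i = Const c" by (cases "as ! i") auto
    show ?thesis
    proof (cases "n = 0")
      \<comment> \<open>Fixing the only argument would lead to arity 0. By nonemptiness the atom is
        true, so it defines the whole cube.\<close>
      case True
      with i c Suc.prems(2) have "as = [Const c]"
        by (cases as) auto
      with Suc.prems(4) have "{t \<in> cube k. map (eval_arg t) as \<in> S} = cube k" by auto
      then show ?thesis by (simp add: qfpp_definable_cube)
    next
      case False
      define bs where "bs = take i as @ drop (Suc i) as"
      have SS: "S \<subseteq> cube (Suc n)" using cl Suc.prems(1) by (auto simp: constraint_language_def)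
      have "map (eval_arg t) bs = drop_coord i (map (eval_arg t) as)" for t
        by (simp add: bs_def drop_coord_def take_map drop_map)
      moreover have "map (eval_arg t) as ! i = c" for t
        using i c Suc.prems(2) by simp
      ultimately have eq: "map (eval_arg t) bs \<in> fix_coord i c S \<longleftrightarrow> map (eval_arg t) as \<in> S" for t
        using mem_fix_coord_iff[OF SS, of "map (eval_arg t) as" i] i Suc.prems(2) by auto
      have "(n, fix_coord i c S) \<in> \<Gamma>"
        using sym Suc.prems(1) i False unfolding sign_symmetric_def by fastforce
      moreover have "length bs = n" using i Suc.prems(2) by (auto simp: bs_def)
      moreover have "\<forall>a \<in> set bs. arg_ok k a"
        using Suc.prems(3) by (auto simp: bs_def dest: in_set_takeD in_set_dropD)
      ultimately show ?thesis
        using Suc.IH[of "fix_coord i c S" bs] Suc.prems(4) unfolding eq by blast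
    qed
  qed
qed

text \<open>
  Nonemptiness is needed because a false atom all of whose arguments are constants cannot be
  expressed without relations of arity 0.
\<close>

lemma lit_definable_imp_qfpp_definable:
  assumes "constraint_language \<Gamma>" "sign_symmetric \<Gamma>" "lit_definable \<Gamma> k R" "R \<noteq> {}"
  shows "qfpp_definable \<Gamma> k R"
  using assms(3,4)
proof induction
  case cube
  then show ?case by (simp add: qfpp_definable_cube)
next
  case (atom n S as)
  then show ?case by (intro lit_atom_definable[OF assms(1,2)]) auto
next
  case (Int A B)
  then show ?case by (intro qfpp_definable_Int) auto
qed


section \<open>Symmetric relations and their weight sets\<close>

lemma weight_eq_length_filter: "weight t = length (filter id t)"
  unfolding weight_def length_filter_conv_card
  by (simp add: of_bool_def sum.If_cases) (rule arg_cong[of _ _ card], auto)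

lemma weight_eq_count: "weight t = count (mset t) True"
  by (induction t) (auto simp: weight_eq_length_filter)

lemma weight_le_length: "weight t \<le> length t"
  by (simp add: weight_eq_length_filter)

lemma mset_eq_iff_weight_eq:
  assumes "length t = length u"
  shows "mset t = mset u \<longleftrightarrow> weight t = weight u"
proof
  assume w: "weight t = weight u"
  have *: "count (mset xs) True + count (mset xs) False = length xs" for xs
    by (induction xs) auto
  have "count (mset t) b = count (mset u) b" for b
    using w *[of t] *[of u] assms by (cases b) (auto simp: weight_eq_count)
  then show "mset t = mset u" by (rule multiset_eqI)
qed (simp add: weight_eq_count)

text \<open>\<open>W\<close> may contain numbers above \<open>k\<close>, so that one weight set
  describes a relation in every arity.\<close>

definition weight_rel :: "nat \<Rightarrow> nat set \<Rightarrow> bool list set" where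
  "weight_rel k W = {t \<in> cube k. weight t \<in> W}"

lemma weight_rel_cong:
  "(\<And>w. w \<le> k \<Longrightarrow> w \<in> V \<longleftrightarrow> w \<in> W) \<Longrightarrow> weight_rel k V = weight_rel k W"
  unfolding weight_rel_def cube_def by (auto simp: weight_le_length)

text \<open>Each variable is repeated \<open>m\<close> times, followed by \<open>c\<close> constants
  \<open>True\<close> and padding with \<open>False\<close> up to arity \<open>n\<close>. The case
  \<open>m = 1\<close>, \<open>c = 0\<close> lowers the arity and keeps the weight set.\<close>

lemma lit_definable_weight_rel_affine:
  assumes "lit_definable \<Gamma> n (weight_rel n W)" "m * k + c \<le> n"
  shows "lit_definable \<Gamma> k (weight_rel k {j. m * j + c \<in> W})"
proof -
  define as where "as = concat (replicate m (map (Lit False) [0..<k]))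
    @ replicate c (Const True) @ replicate (n - (m * k + c)) (Const False)"
  have len: "length as = n"
    using assms(2) by (simp add: as_def length_concat sum_list_replicate)
  have ok: "\<forall>a \<in> set as. arg_ok k a"
    by (auto simp: as_def)
  have ev: "map (eval_arg t) as = concat (replicate m t) @ replicate c True
      @ replicate (n - (m * k + c)) False" if "length t = k" for t
  proof -
    have "map (eval_arg t) (map (Lit False) [0..<k]) = t"
      using that by (auto intro: nth_equalityI)
    then show ?thesis by (simp add: as_def map_concat map_replicate)
  qed
  have "weight (concat (replicate m t)) = m * weight t" for t
    by (induction m) (auto simp: weight_eq_length_filter)
  then have "weight (map (eval_arg t) as) = m * weight t + c" if "length t = k" for t
    unfolding ev[OF that] by (simp add: weight_eq_length_filter)
  then have "{t \<in> cube k. map (eval_arg t) as \<in> weight_rel n W} = weight_rel k {j. m * j + c \<in> W}"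
    unfolding weight_rel_def using len by (auto simp: cube_def)
  with lit_definable_subst[OF assms(1) len ok] show ?thesis by simp
qed

text \<open>Intersecting all coordinate permutations of \<open>Q\<close> keeps a tuple iff its whole
  orbit lies in \<open>Q\<close>, and an orbit consists of all tuples of one weight.\<close>

lemma lit_definable_symmetrize:
  assumes "lit_definable \<Gamma> k Q" "Q \<subseteq> cube k"
  shows "lit_definable \<Gamma> k (weight_rel k {w. \<forall>t \<in> cube k. weight t = w \<longrightarrow> t \<in> Q})"
proof -
  define P where "P = {p. p permutes {..<k}}"
  have "lit_definable \<Gamma> k {t \<in> cube k. permute_list p t \<in> Q}" if "p \<in> P" for p
  proof -
    have "map (eval_arg t) (map (\<lambda>i. Lit False (p i)) [0..<k]) = permute_list p t"
      if "t \<in> cube k" for t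
      using that by (simp add: permute_list_def cube_def)
    then have "{t \<in> cube k. permute_list p t \<in> Q}
        = {t \<in> cube k. map (eval_arg t) (map (\<lambda>i. Lit False (p i)) [0..<k]) \<in> Q}"
      by auto
    moreover have "i < k \<Longrightarrow> p i < k" for i
      using that permutes_in_image[of p "{..<k}" i] by (simp add: P_def)
    ultimately show ?thesis
      using lit_definable_subst[OF assms(1), of "map (\<lambda>i. Lit False (p i)) [0..<k]" k] by auto
  qed
  then have "lit_definable \<Gamma> k (cube k \<inter> (\<Inter>p\<in>P. {t \<in> cube k. permute_list p t \<in> Q}))"
    by (intro lit_definable_INT) (auto simp: P_def finite_permutations)
  moreover have "cube k \<inter> (\<Inter>p\<in>P. {t \<in> cube k. permute_list p t \<in> Q})
      = weight_rel k {w. \<forall>t \<in> cube k. weight t = w \<longrightarrow> t \<in> Q}"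
  proof (intro equalityI subsetI)
    fix t assume t: "t \<in> cube k \<inter> (\<Inter>p\<in>P. {t \<in> cube k. permute_list p t \<in> Q})"
    have "u \<in> Q" if "u \<in> cube k" "weight u = weight t" for u
    proof -
      have "mset u = mset t"
        using that t by (intro iffD2[OF mset_eq_iff_weight_eq]) (auto simp: cube_def)
      then obtain p where "p permutes {..<length t}" "permute_list p t = u"
        by (metis mset_eq_permutation)
      with t show ?thesis by (auto simp: P_def cube_def)
    qed
    with t show "t \<in> weight_rel k {w. \<forall>t \<in> cube k. weight t = w \<longrightarrow> t \<in> Q}"
      by (auto simp: weight_rel_def)
  next
    fix t assume t: "t \<in> weight_rel k {w. \<forall>t \<in> cube k. weight t = w \<longrightarrow> t \<in> Q}"
    have "permute_list p t \<in> Q" if "p \<in> P" for p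
    proof -
      have "mset (permute_list p t) = mset t"
        using that t by (intro mset_permute_list) (auto simp: P_def weight_rel_def cube_def)
      then have "weight (permute_list p t) = weight t" by (simp add: weight_eq_count)
      then show ?thesis using t by (auto simp: weight_rel_def cube_def)
    qed
    with t show "t \<in> cube k \<inter> (\<Inter>p\<in>P. {t \<in> cube k. permute_list p t \<in> Q})"
      by (auto simp: weight_rel_def)
  qed
  ultimately show ?thesis by simp
qed

section \<open>From failure of near-unanimity to a relation with all unit vectors but not
  zero\<close>

lemma weight_eq_0_iff: "weight t = 0 \<longleftrightarrow> t = replicate (length t) False"
  by (induction t) (auto simp: weight_eq_length_filter)

lemma weight_eq_1_imp_unit:
  assumes "weight t = 1"
  obtains j where "j < length t" "\<And>i. i < length t \<Longrightarrow> t ! i \<longleftrightarrow> i = j"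
proof -
  have "card {i. i < length t \<and> t ! i} = 1"
    using assms by (simp add: weight_eq_length_filter length_filter_conv_card)
  then obtain j where "{i. i < length t \<and> t ! i} = {j}" by (auto simp: card_1_singleton_iff)
  then have "j < length t" "\<And>i. i < length t \<Longrightarrow> t ! i \<longleftrightarrow> i = j"
    by blast+
  then show thesis by (rule that)
qed

lemma partial_nu_eq_Some_imp:
  "partial_nu k xs = Some x \<Longrightarrow> card {i. i < k \<and> xs ! i \<noteq> x} \<le> 1"
  by (auto simp: partial_nu_def nearly_constant_def split: if_splits)

text \<open>The tuples \<open>ts\<close> in \<open>R\<close> yield \<open>u\<close> outside
  \<open>R\<close>, and at each position at most one of them disagrees with \<open>u\<close>. With
  \<open>u\<close> as the origin, variable \<open>j\<close> switches on exactly the disagreements of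
  \<open>ts ! j\<close>: the zero vector is sent to \<open>u\<close> and the \<open>j\<close>-th
  unit vector to \<open>ts ! j\<close>.\<close>

lemma not_preserved_imp_unit_relation:
  assumes "constraint_language \<Gamma>" "\<not> preserves_language k (partial_nu k) \<Gamma>"
  obtains Q where "lit_definable \<Gamma> k Q" "Q \<subseteq> cube k" "replicate k False \<notin> Q"
    "\<And>t. t \<in> cube k \<Longrightarrow> weight t = 1 \<Longrightarrow> t \<in> Q"
proof -
  obtain n R ts u where R: "(n, R) \<in> \<Gamma>" and ts: "length ts = k" "set ts \<subseteq> R"
    and u: "length u = n" "\<And>i. i < n \<Longrightarrow> partial_nu k (map (\<lambda>t. t ! i) ts) = Some (u ! i)" "u \<notin> R"
    using assms(2) unfolding preserves_language_def preserves_def by fastforce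
  define D where "D i = {j. j < k \<and> ts ! j ! i \<noteq> u ! i}" for i
  \<comment> \<open>The literal takes the value \<open>u ! i\<close> when its variable is
    \<open>False\<close>. A nonempty \<open>D i\<close> with \<open>i < n\<close> is a singleton, so
    the choice is forced.\<close>
  define arg where "arg i = (if D i = {} then Const (u ! i) else Lit (u ! i) (SOME j. j \<in> D i))" for i
  have D: "card (D i) \<le> 1" if "i < n" for i
  proof -
    have "D i = {j. j < k \<and> map (\<lambda>t. t ! i) ts ! j \<noteq> u ! i}"
      using ts(1) by (auto simp: D_def)
    then show ?thesis using partial_nu_eq_Some_imp[OF u(2)[OF that]] by simp
  qed
  have D_cases: "D i = {} \<or> (\<exists>j. D i = {j})" if "i < n" for i
  proof -
    have "finite (D i)" by (simp add: D_def)
    then show ?thesis using D[OF that] by (metis One_nat_def card_0_eq card_1_singletonE le_SucE le_zero_eq)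
  qed
  define as where "as = map arg [0..<n]"
  define Q where "Q = {t \<in> cube k. map (eval_arg t) as \<in> R}"
  have ok: "arg_ok k (arg i)" if "i < n" for i
  proof (cases "D i = {}")
    case False
    then have "(SOME j. j \<in> D i) \<in> D i" by (simp add: some_in_eq)
    with False show ?thesis by (simp add: arg_def) (simp add: D_def)
  qed (simp add: arg_def)
  have "lit_definable \<Gamma> k Q"
    unfolding Q_def using R ok by (intro lit_definable.atom) (auto simp: as_def)
  moreover have "replicate k False \<notin> Q"
  proof -
    have "map (eval_arg (replicate k False)) as = u"
    proof (rule nth_equalityI)
      fix i assume "i < length (map (eval_arg (replicate k False)) as)"
      then have "i < n" by (simp add: as_def)
      then show "map (eval_arg (replicate k False)) as ! i = u ! i"
        using ok[of i] by (auto simp: as_def arg_def split: if_splits)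
    qed (simp add: as_def u)
    with u(3) show ?thesis by (simp add: Q_def)
  qed
  moreover have "t \<in> Q" if t: "t \<in> cube k" "weight t = 1" for t
  proof -
    obtain j where j: "j < k" "\<And>i. i < k \<Longrightarrow> t ! i \<longleftrightarrow> i = j"
      using weight_eq_1_imp_unit[OF t(2)] t(1) by (auto simp: cube_def)
    have jR: "ts ! j \<in> R" using j(1) ts by auto
    have len: "length (ts ! j) = n"
      using jR assms(1) R by (auto simp: constraint_language_def cube_def)
    have "map (eval_arg t) as = ts ! j"
    proof (rule nth_equalityI)
      fix i assume "i < length (map (eval_arg t) as)"
      then have i: "i < n" by (simp add: as_def)
      consider "D i = {}" | l where "D i = {l}" using D_cases[OF i] by blast
      then show "map (eval_arg t) as ! i = ts ! j ! i"
      proof cases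
        case 1
        then have "ts ! j ! i = u ! i" using j(1) by (auto simp: D_def)
        with 1 i show ?thesis by (simp add: as_def arg_def)
      next
        case 2
        then have l: "l < k" "ts ! l ! i \<noteq> u ! i" and "\<And>l'. l' < k \<Longrightarrow> ts ! l' ! i \<noteq> u ! i \<longleftrightarrow> l' = l"
          by (auto simp: D_def)
        then have "ts ! j ! i \<noteq> u ! i \<longleftrightarrow> j = l" using j(1) by blast
        with 2 i j l show ?thesis by (auto simp: as_def arg_def)
      qed
    qed (simp add: as_def len)
    with jR t show ?thesis by (simp add: Q_def)
  qed
  ultimately show thesis by (intro that[of Q]) (auto simp: Q_def)
qed


section \<open>The least weight set containing 1\<close>

definition limit_weights :: "brel set \<Rightarrow> nat set set" where
  "limit_weights \<Gamma> = {W. \<forall>k. lit_definable \<Gamma> k (weight_rel k W)}"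

lemma limit_weights_affine:
  assumes "W \<in> limit_weights \<Gamma>"
  shows "{j. m * j + c \<in> W} \<in> limit_weights \<Gamma>"
  using assms lit_definable_weight_rel_affine[OF _ order_refl]
  unfolding limit_weights_def by blast

text \<open>The least weight set containing 1 is built arity by arity: in arity \<open>n\<close>
  only weights up to \<open>n\<close> matter, which leaves finitely many sets to intersect.\<close>

definition core :: "brel set \<Rightarrow> nat \<Rightarrow> nat set" where
  "core \<Gamma> n = {w. w \<le> n \<and> (\<forall>V. lit_definable \<Gamma> n (weight_rel n V) \<and> 1 \<in> V \<longrightarrow> w \<in> V)}"

lemma lit_definable_core: "lit_definable \<Gamma> n (weight_rel n (core \<Gamma> n))"
proof -
  \<comment> \<open>Each candidate is represented by its part up to \<open>n\<close>, which makes
    the family finite. \<open>insert 1\<close> restores 1, which is cut off when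
    \<open>n = 0\<close>.\<close>
  define I where "I = {V \<in> Pow {..n}. lit_definable \<Gamma> n (weight_rel n (insert 1 V))}"
  have "lit_definable \<Gamma> n (cube n \<inter> (\<Inter>V\<in>I. weight_rel n (insert 1 V)))"
    by (intro lit_definable_INT) (auto simp: I_def)
  moreover have "cube n \<inter> (\<Inter>V\<in>I. weight_rel n (insert 1 V)) = weight_rel n (core \<Gamma> n)"
  proof (intro equalityI subsetI)
    fix t assume t: "t \<in> cube n \<inter> (\<Inter>V\<in>I. weight_rel n (insert 1 V))"
    then have len: "weight t \<le> n" using weight_le_length[of t] by (simp add: cube_def)
    have "weight t \<in> V" if V: "lit_definable \<Gamma> n (weight_rel n V)" "1 \<in> V" for V
    proof -
      have "weight_rel n (insert 1 (V \<inter> {..n})) = weight_rel n V"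
        using V(2) by (intro weight_rel_cong) auto
      then have "V \<inter> {..n} \<in> I" using V by (simp add: I_def)
      with t have "t \<in> weight_rel n (insert 1 (V \<inter> {..n}))" by blast
      then show ?thesis using V(2) by (auto simp: weight_rel_def)
    qed
    with t len show "t \<in> weight_rel n (core \<Gamma> n)" by (auto simp: weight_rel_def core_def)
  next
    fix t assume t: "t \<in> weight_rel n (core \<Gamma> n)"
    then have "weight t \<in> insert 1 V" if "V \<in> I" for V
      using that unfolding weight_rel_def core_def I_def by blast
    with t show "t \<in> cube n \<inter> (\<Inter>V\<in>I. weight_rel n (insert 1 V))"
      by (simp add: weight_rel_def)
  qed
  ultimately show ?thesis by simp
qed

text \<open>A weight set definable in arity \<open>N\<close> is definable in the smaller arity
  \<open>n\<close> too, so the larger arity adds no candidates.\<close>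

lemma core_mono:
  assumes "n \<le> N"
  shows "core \<Gamma> n \<subseteq> core \<Gamma> N"
proof
  fix w assume w: "w \<in> core \<Gamma> n"
  have "w \<in> V" if "lit_definable \<Gamma> N (weight_rel N V)" "1 \<in> V" for V
    using lit_definable_weight_rel_affine[OF that(1), of 1 n 0] w that(2) assms
    by (simp add: core_def)
  with w assms show "w \<in> core \<Gamma> N" by (auto simp: core_def)
qed

text \<open>The cores increase, so membership of each weight is eventually constant. In arity
  \<open>k\<close> only weights up to \<open>k\<close> count, and a single large core decides all of
  them.\<close>

lemma UN_core_in_limit_weights: "(\<Union>n. core \<Gamma> n) \<in> limit_weights \<Gamma>"
proof -
  have "lit_definable \<Gamma> k (weight_rel k (\<Union>n. core \<Gamma> n))" for k
  proof -
    have "\<exists>N. \<forall>n\<ge>N. w \<in> (\<Union>n. core \<Gamma> n) \<longleftrightarrow> w \<in> core \<Gamma> n" for w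
      using core_mono[of _ _ \<Gamma>] by blast
    then obtain f where f: "\<And>w n. f w \<le> n \<Longrightarrow> w \<in> (\<Union>n. core \<Gamma> n) \<longleftrightarrow> w \<in> core \<Gamma> n"
      by metis
    \<comment> \<open>The sum dominates every threshold \<open>f w\<close> with
      \<open>w \<le> k\<close>; the summand \<open>k\<close> allows the restriction from arity
      \<open>N\<close> to arity \<open>k\<close>.\<close>
    define N where "N = k + (\<Sum>w\<le>k. f w)"
    have "weight_rel k (\<Union>n. core \<Gamma> n) = weight_rel k (core \<Gamma> N)"
    proof (rule weight_rel_cong)
      fix w assume "w \<le> k"
      then have "f w \<le> N" unfolding N_def
        by (intro trans_le_add2 member_le_sum) auto
      then show "w \<in> (\<Union>n. core \<Gamma> n) \<longleftrightarrow> w \<in> core \<Gamma> N" by (rule f)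
    qed
    moreover have "lit_definable \<Gamma> k (weight_rel k (core \<Gamma> N))"
      using lit_definable_weight_rel_affine[OF lit_definable_core, of 1 k 0 N \<Gamma>] by (simp add: N_def)
    ultimately show ?thesis by simp
  qed
  then show ?thesis by (simp add: limit_weights_def)
qed

lemma UN_core_least:
  assumes "V \<in> limit_weights \<Gamma>" "1 \<in> V"
  shows "(\<Union>n. core \<Gamma> n) \<subseteq> V"
  using assms by (auto simp: core_def limit_weights_def)

lemma one_in_UN_core: "1 \<in> (\<Union>n. core \<Gamma> n)"
  by (rule UN_I[of 1]) (auto simp: core_def)

text \<open>If 0 were in some core, it would be in all later ones; yet in any arity from 3 on,
  symmetrizing the unit relation gives a candidate with 1 but without 0.\<close>

lemma zero_notin_UN_core:
  assumes "constraint_language \<Gamma>" "\<And>k. 3 \<le> k \<Longrightarrow> \<not> preserves_language k (partial_nu k) \<Gamma>"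
  shows "0 \<notin> (\<Union>n. core \<Gamma> n)"
proof
  assume "0 \<in> (\<Union>n. core \<Gamma> n)"
  then obtain n where "0 \<in> core \<Gamma> n" by auto
  then have 0: "0 \<in> core \<Gamma> (n + 3)" using core_mono[of n "n + 3" \<Gamma>] by auto
  obtain Q where Q: "lit_definable \<Gamma> (n + 3) Q" "Q \<subseteq> cube (n + 3)" "replicate (n + 3) False \<notin> Q"
    "\<And>t. t \<in> cube (n + 3) \<Longrightarrow> weight t = 1 \<Longrightarrow> t \<in> Q"
    using not_preserved_imp_unit_relation[OF assms(1) assms(2)[of "n + 3"]] by auto
  define V where "V = {w. \<forall>t \<in> cube (n + 3). weight t = w \<longrightarrow> t \<in> Q}"
  have "1 \<in> V" using Q(4) by (auto simp: V_def)
  then have "0 \<in> V"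
    using 0 lit_definable_symmetrize[OF Q(1,2)] by (auto simp: core_def V_def)
  then have "replicate (n + 3) False \<in> Q"
    by (simp add: V_def cube_def weight_eq_length_filter)
  with Q(3) show False by simp
qed


section \<open>Numerical semigroups\<close>

text \<open>\<open>d\<close> is the least positive difference of two elements \<open>s\<close> and
  \<open>s + d\<close>. A nonzero remainder modulo \<open>d\<close> would be a smaller difference;
  and as \<open>s\<close> is a multiple of \<open>d\<close>, sums of copies of \<open>s\<close> and
  \<open>s + d\<close> reach every large multiple of \<open>d\<close>.\<close>

lemma numerical_semigroup_eventually_multiples:
  fixes S :: "nat set"
  assumes zero: "0 \<in> S" and add: "\<And>a b. a \<in> S \<Longrightarrow> b \<in> S \<Longrightarrow> a + b \<in> S" and "S \<noteq> {0}"
  obtains d N where "d > 0" "\<And>a. a \<in> S \<Longrightarrow> d dvd a" "\<And>a. a \<ge> N \<Longrightarrow> d dvd a \<Longrightarrow> a \<in> S"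
proof -
  define P where "P d \<longleftrightarrow> d > 0 \<and> (\<exists>s\<in>S. s + d \<in> S)" for d
  define d where "d = (LEAST d. P d)"
  from zero \<open>S \<noteq> {0}\<close> obtain x where "x \<in> S" "x \<noteq> 0" by blast
  then have "P x" unfolding P_def using zero by (metis add_0 gr0I)
  then have "P d" unfolding d_def by (rule LeastI)
  have least: "d \<le> e" if "P e" for e
    unfolding d_def using that by (rule Least_le)
  from \<open>P d\<close> obtain s0 where "d > 0" and s0: "s0 \<in> S" "s0 + d \<in> S" by (auto simp: P_def)
  \<comment> \<open>\<open>s0\<close> may be 0; this sum is positive, and \<open>s + d\<close> is
    still in \<open>S\<close>.\<close>
  define s where "s = s0 + (s0 + d)"
  have s: "s \<in> S" "s + d \<in> S" "s > 0"
    using add[OF s0] add[OF s0(2) s0(2)] \<open>d > 0\<close> by (auto simp: s_def algebra_simps)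
  have mult: "q * a \<in> S" if "a \<in> S" for q a
    by (induction q) (use zero add that in auto)
  have dvd: "d dvd a" if "a \<in> S" for a
  proof (rule ccontr)
    assume "\<not> d dvd a"
    then have r: "a mod d > 0" by (simp add: dvd_eq_mod_eq_0)
    \<comment> \<open>These are two elements of \<open>S\<close> that differ by
      \<open>a mod d\<close>.\<close>
    have "(a div d) * (s + d) + a mod d = a + (a div d) * s"
      by (simp add: algebra_simps)
    moreover have "(a div d) * (s + d) \<in> S" "a + (a div d) * s \<in> S"
      using mult add that s by auto
    ultimately have "P (a mod d)" unfolding P_def using r by metis
    then have "d \<le> a mod d" by (rule least)
    with mod_less_divisor[OF \<open>d > 0\<close>, of a] show False by simp
  qed
  obtain s' where s': "s = d * s'" using dvd[OF s(1)] by blast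
  with s(3) have "s' > 0" by auto
  \<comment> \<open>Up to the factor \<open>d\<close>, \<open>s\<close> and \<open>s + d\<close> are
    the consecutive numbers \<open>s'\<close> and \<open>s' + 1\<close>. Writing \<open>m\<close> as
    a sum of \<open>m div s'\<close> of them, \<open>m mod s'\<close> being \<open>s' + 1\<close>,
    requires \<open>m mod s' \<le> m div s'\<close>, which the bound \<open>s' * s'\<close>
    ensures.\<close>
  have "a \<in> S" if "d * (s' * s') \<le> a" "d dvd a" for a
  proof -
    obtain m where m: "a = d * m" using \<open>d dvd a\<close> by blast
    with that(1) \<open>d > 0\<close> have "s' * s' \<le> m" by simp
    then have "s' \<le> m div s'" using \<open>s' > 0\<close> by (simp add: less_eq_div_iff_mult_less_eq)
    moreover have "m mod s' < s'" using \<open>s' > 0\<close> by simp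
    ultimately have "m mod s' \<le> m div s'" by simp
    then obtain e where e: "m div s' = m mod s' + e" using le_Suc_ex by blast
    have "m = (m mod s' + e) * s' + m mod s'"
      unfolding e[symmetric] by simp
    then have "a = d * ((m mod s' + e) * s' + m mod s')" using m by simp
    also have "\<dots> = (m mod s') * (s + d) + e * s" by (simp add: s' algebra_simps)
    finally show "a \<in> S" using mult add s by simp
  qed
  with \<open>d > 0\<close> dvd show thesis by (rule that)
qed


section \<open>The trichotomy\<close>

text \<open>The literals are true exactly where a tuple differs from \<open>t\<close>, so their
  weight is the Hamming distance to \<open>t\<close>.\<close>

lemma clause_definable:
  assumes "{j. 1 \<le> j} \<in> limit_weights \<Gamma>" "t \<in> cube k"
  shows "lit_definable \<Gamma> k (cube k - {t})"
proof -
  define as where "as = map (\<lambda>i. Lit (t ! i) i) [0..<k]"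
  have "lit_definable \<Gamma> k {x \<in> cube k. map (eval_arg x) as \<in> weight_rel k {j. 1 \<le> j}}"
    using assms by (intro lit_definable_subst) (auto simp: limit_weights_def as_def)
  moreover have "map (eval_arg x) as \<in> weight_rel k {j. 1 \<le> j} \<longleftrightarrow> x \<noteq> t" if "x \<in> cube k" for x
  proof -
    have "weight (map (eval_arg x) as) = 0 \<longleftrightarrow> map (eval_arg x) as = replicate k False"
      by (simp add: weight_eq_0_iff as_def)
    also have "\<dots> \<longleftrightarrow> x = t"
      using that assms(2) by (auto simp: as_def cube_def list_eq_iff_nth_eq)
    finally show ?thesis by (auto simp: weight_rel_def cube_def as_def)
  qed
  ultimately show ?thesis by (simp add: set_diff_eq cong: conj_cong)
qed

lemma clause_nonempty: "k \<ge> 1 \<Longrightarrow> cube k - {t} \<noteq> {}"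
proof -
  assume "k \<ge> 1"
  then have "replicate k True \<noteq> replicate k False" by (cases k) auto
  moreover have "replicate k True \<in> cube k" "replicate k False \<in> cube k" by (auto simp: cube_def)
  ultimately show ?thesis by blast
qed

lemma exists_weight: "w \<le> k \<Longrightarrow> \<exists>t \<in> cube k. weight t = w"
  by (rule bexI[of _ "replicate w True @ replicate (k - w) False"])
    (auto simp: weight_eq_length_filter cube_def)

text \<open>The translation from \<open>lit_definable\<close> covers nonempty relations; empty ones
  are expressed through the residues 0 and 1, whose unary relations are nonempty.\<close>

lemma mod_rel_definable:
  assumes \<Gamma>: "constraint_language \<Gamma>" "sign_symmetric \<Gamma>" and "prime p"
    and lit: "\<And>k a. a < p \<Longrightarrow> lit_definable \<Gamma> k (mod_rel p a k)"
    and "k \<ge> 1" "a < p"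
  shows "qfpp_definable \<Gamma> k (mod_rel p a k)"
proof (cases "mod_rel p a k = {}")
  case False
  with lit[OF \<open>a < p\<close>] show ?thesis
    by (intro lit_definable_imp_qfpp_definable[OF \<Gamma>])
next
  \<comment> \<open>This happens when \<open>k < a\<close>; the relation is then defined by \<open>x\<^sub>0 \<equiv> 0 \<and> x\<^sub>0 \<equiv> 1\<close>.\<close>
  case True
  have p: "p \<ge> 2" using \<open>prime p\<close> by (rule prime_ge_2_nat)
  have ne: "mod_rel p b 1 \<noteq> {}" if "b \<le> 1" for b
    using exists_weight[OF that] by (auto simp: mod_rel_def)
  have "qfpp_definable \<Gamma> k {t \<in> cube k. take 1 t \<in> mod_rel p b 1}" if "b \<le> 1" for b
    using lit[of b 1] ne[OF that] that p \<open>k \<ge> 1\<close>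
    by (intro qfpp_definable_weaken_arity lit_definable_imp_qfpp_definable[OF \<Gamma>]) auto
  from qfpp_definable_Int[OF this[of 0] this[of 1]]
  have "qfpp_definable \<Gamma> k ({t \<in> cube k. take 1 t \<in> mod_rel p 0 1}
      \<inter> {t \<in> cube k. take 1 t \<in> mod_rel p 1 1})" by simp
  moreover have "{t \<in> cube k. take 1 t \<in> mod_rel p 0 1}
      \<inter> {t \<in> cube k. take 1 t \<in> mod_rel p 1 1} = {}"
    using p by (auto simp: mod_rel_def)
  ultimately show ?thesis using True by simp
qed

theorem theorem10:
  fixes \<Gamma> :: "brel set"
  assumes "constraint_language \<Gamma>"
    and "sign_symmetric \<Gamma>"
    and "\<And>k. 3 \<le> k \<Longrightarrow> \<not> preserves_language k (partial_nu k) \<Gamma>"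
  shows "(\<forall>k\<ge>1. \<forall>C \<in> clauses k. qfpp_definable \<Gamma> k C)
    \<or> (\<forall>k\<ge>1. qfpp_definable \<Gamma> k (one_in k))
    \<or> (\<exists>p. prime p \<and> (\<forall>k\<ge>1. \<forall>a<p. qfpp_definable \<Gamma> k (mod_rel p a k)))"
proof -
  define W where "W = (\<Union>n. core \<Gamma> n)"
  have W: "W \<in> limit_weights \<Gamma>" "1 \<in> W" "0 \<notin> W"
    unfolding W_def
    by (rule UN_core_in_limit_weights one_in_UN_core zero_notin_UN_core[OF assms(1,3)] | assumption)+
  have least: "W \<subseteq> V" if "V \<in> limit_weights \<Gamma>" "1 \<in> V" for V
    unfolding W_def using that by (rule UN_core_least)
  define S where "S = {a. a + 1 \<in> W}"
  have zero: "0 \<in> S" using W by (simp add: S_def)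
  have add: "a + b \<in> S" if "a \<in> S" "b \<in> S" for a b
  proof -
    \<comment> \<open>The right-hand set contains 1 because \<open>a \<in> S\<close>, so minimality
      of \<open>W\<close> applies; the inclusion is then used at \<open>b + 1\<close>.\<close>
    have "W \<subseteq> {j. 1 * j + a \<in> W}"
      using that W by (intro least limit_weights_affine) (auto simp: S_def)
    with that show ?thesis by (auto simp: S_def add_ac)
  qed
  note definable = lit_definable_imp_qfpp_definable[OF assms(1,2)]
  show ?thesis
  proof (cases "S = {0}")
    case True
    have W1: "w \<in> W \<longleftrightarrow> w = 1" for w
      using W True by (cases w) (auto simp: S_def)
    have eq: "one_in k = weight_rel k W" for k
      by (simp add: one_in_def weight_rel_def W1)
    have ne: "one_in k \<noteq> {}" if "k \<ge> 1" for k
      using exists_weight[OF that] by (auto simp: one_in_def)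
    have "qfpp_definable \<Gamma> k (one_in k)" if "k \<ge> 1" for k
      using ne[OF that] W(1) unfolding eq by (intro definable) (auto simp: limit_weights_def)
    then show ?thesis by blast
  next
    case False
    obtain d N where "d > 0" and dvd: "\<And>a. a \<in> S \<Longrightarrow> d dvd a"
      and S: "\<And>a. a \<ge> N \<Longrightarrow> d dvd a \<Longrightarrow> a \<in> S"
      using numerical_semigroup_eventually_multiples[OF zero add False] by metis
    show ?thesis
    proof (cases "d = 1")
      case True
      \<comment> \<open>For \<open>j = i + 1\<close> the multiple is \<open>N + i * (N + 1)\<close>
        plus 1, and every number from \<open>N\<close> on is in \<open>S\<close>; for
        \<open>j = 0\<close> it is 0, outside \<open>W\<close>.\<close>
      have "(N + 1) * j + 0 \<in> W \<longleftrightarrow> 1 \<le> j" for j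
      proof (cases j)
        case (Suc i)
        have "N + i * (N + 1) \<in> S" using S True by simp
        with Suc show ?thesis by (simp add: S_def algebra_simps)
      qed (use W in simp)
      then have "{j. 1 \<le> j} \<in> limit_weights \<Gamma>"
        using limit_weights_affine[OF W(1), of "N + 1" 0] by simp
      then have "qfpp_definable \<Gamma> k C" if "k \<ge> 1" "C \<in> clauses k" for k C
        using that clause_definable clause_nonempty
        unfolding clauses_def by (auto intro!: definable)
      then show ?thesis by blast
    next
      case False
      then obtain p where "prime p" "p dvd d" using prime_factor_nat by blast
      then obtain m where m: "d = p * m" by blast
      with \<open>d > 0\<close> have "m > 0" by auto
      have "lit_definable \<Gamma> k (mod_rel p a k)" if "a < p" for k a
      proof -
        \<comment> \<open>The 1 passes from \<open>W\<close> to \<open>S\<close>;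
          \<open>d * N\<close> moves past the threshold \<open>N\<close> without affecting
          divisibility by \<open>d\<close>; \<open>m * (p - a)\<close>, not truncated as
          \<open>a < p\<close>, aligns the residue, since \<open>d = p * m\<close>.\<close>
        have "m * j + (m * (p - a) + d * N + 1) \<in> W \<longleftrightarrow> j mod p = a mod p" for j
        proof -
          have "m * j + (m * (p - a) + d * N + 1) \<in> W \<longleftrightarrow> m * (j + (p - a)) + d * N \<in> S"
            by (simp add: S_def algebra_simps)
          also have "\<dots> \<longleftrightarrow> d dvd m * (j + (p - a)) + d * N"
            using dvd S[of "m * (j + (p - a)) + d * N"] \<open>d > 0\<close>
            by (metis mult_le_mono1 nat_mult_1 Suc_leI One_nat_def trans_le_add2)
          also have "\<dots> \<longleftrightarrow> d dvd m * (j + (p - a))" by (simp add: dvd_add_left_iff)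
          also have "\<dots> \<longleftrightarrow> p dvd j + (p - a)"
            using m \<open>m > 0\<close> by (simp add: mult.commute[of p])
          \<comment> \<open>Integers are used because \<open>j\<close> may be smaller than
            \<open>a\<close>.\<close>
          also have "\<dots> \<longleftrightarrow> int p dvd int j - int a"
          proof -
            have "int (j + (p - a)) = (int j - int a) + int p" using that by simp
            then show ?thesis by (metis dvd_add_left_iff dvd_refl int_dvd_int_iff)
          qed
          also have "\<dots> \<longleftrightarrow> j mod p = a mod p"
            by (metis mod_eq_dvd_iff of_nat_eq_iff zmod_int)
          finally show ?thesis .
        qed
        then have "mod_rel p a k = weight_rel k {j. m * j + (m * (p - a) + d * N + 1) \<in> W}"
          by (simp add: mod_rel_def weight_rel_def)
        then show ?thesis
          using limit_weights_affine[OF W(1), of m "m * (p - a) + d * N + 1"]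
          by (simp add: limit_weights_def)
      qed
      then show ?thesis
        using mod_rel_definable[OF assms(1,2) \<open>prime p\<close>] \<open>prime p\<close> by blast
    qed
  qed
qed

end
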